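(* Let $X$ be a non-empty compact metric space, $T:X\to X$ continuous, and $\Phi=\{\phi_n\}_{n\ge1}\subset C(X,\mathbb R)$ an almost additive sequence. Let $\mathcal Z=\{Z_0\}\cup\{Z_i:i\ge1\}$ be a countable $\Phi$-leafwise maximizable family of non-empty closed invariant subsets of $X$. Suppose that $(Z_i,T)$ has relative $(\Phi|_{Z_i})$-TPO for every $i\ge1$. Then $$\mathcal P^\Phi\cup\operatorname{int}(\operatorname{Lip}^\Phi_{Z_0})$$ is open and dense in $\operatorname{Lip}(X)$. Hence $(X,T)$ has relative $\Phi$-TPO if $\operatorname{int}(\operatorname{Lip}^\Phi_{Z_0})=\varnothing$. The same conclusion holds when the family has no boundary set $Z_0$: if $\{Z_i:i\ge1\}$ is itself a $\Phi$-leafwise maximizable family and each $(Z_i,T)$ has relative $(\Phi|_{Z_i})$-TPO, then $\mathcal P^\Phi$ is open and dense and $(X,T)$ has relative $\Phi$-TPO.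
   Context: A sequence $\Phi=\{\phi_n\}_{n\ge1}\subset C(X,\mathbb R)$ is almost additive if there is $C_\Phi\ge0$ with $\|\phi_{n+m}-\phi_n-\phi_m\circ T^n\|_\infty\le C_\Phi$ for all $n,m\ge1$. $\mathcal M(X,T)$ is the set of $T$-invariant Borel probability measures; for closed invariant $Z$ (i.e. $T(Z)\subset Z$), $\mathcal M(Z,T)$ is the set of those supported on $Z$. The limit $\Phi_*(\mu)=\lim_n\frac1n\int\phi_n\,d\mu$ exists for all $\mu\in\mathcal M(X,T)$, and $\mathcal M_{\max}(X,T,\Phi)=\{\mu\in\mathcal M(X,T):\Phi_*(\mu)=\max_{\nu\in\mathcal M(X,T)}\Phi_*(\nu)\}$. $\operatorname{Lip}(X)$ is the Banach space of real Lipschitz functions with norm $\|f\|_{\operatorname{Lip}}=\|f\|_\infty+|f|_{\operatorname{Lip}}$, $|f|_{\operatorname{Lip}}$ the best Lipschitz constant; all topological notions below refer to this norm. For $f\in\operatorname{Lip}(X)$, $\Phi^f=\{\phi_n+S_nf\}_{n\ge1}$, $S_nf=\sum_{j=0}^{n-1}f\circ T^j$. For closed invariant $Z$, $\operatorname{Lip}^\Phi_Z=\{f\in\operatorname{Lip}(X):\mathcal M_{\max}(X,T,\Phi^f)\cap\mathcal M(Z,T)\ne\varnothing\}$. A family $\mathcal Z$ of closed invariant sets is $\Phi$-leafwise maximizable if $\operatorname{Lip}(X)=\bigcup_{Z\in\mathcal Z}\operatorname{Lip}^\Phi_Z$. $\mu_Q$ is the invariant probability measure on the periodic orbit $Q$.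 $\mathcal P^\Phi=\operatorname{int}\{f\in\operatorname{Lip}(X):\mathcal M_{\max}(X,T,\Phi^f)=\{\mu_Q\}\text{ for some periodic orbit }Q\}$. $(X,T)$ has relative $\Phi$-TPO if there is an open dense set of $f\in\operatorname{Lip}(X)$ such that $\mathcal M_{\max}(X,T,\Phi^f)=\{\mu_Q\}$ for some periodic orbit $Q$ (depending on $f$). Relative $(\Phi|_{Z})$-TPO of $(Z,T)$ is the same notion for the system $(Z,T|_Z)$, the sequence $\Phi|_Z=\{\phi_n|_Z\}$ and the space $\operatorname{Lip}(Z)$. *)

theory Defs
  imports "HOL-Probability.Probability"
begin

text \<open>
  A dynamical system is a carrier set \<open>X\<close> in a metric space together with a map \<open>T\<close> of the ambient
  type with \<open>T ` X \<subseteq> X\<close>. Every notion below evaluates \<open>T\<close> and \<open>\<phi> n\<close> on the carrier only, so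
  instantiating it with a subset \<open>Z\<close> and the same \<open>T\<close> and \<open>\<phi>\<close> gives the notion for the subsystem
  \<open>(Z, T|Z)\<close> with the sequence \<open>\<phi>|Z\<close>. Sequences are indexed by \<open>n \<ge> 1\<close>; \<open>\<phi> 0\<close> is irrelevant.
\<close>

text \<open>Functions on \<open>X\<close> are represented extensionally, so that equality is equality on \<open>X\<close>.\<close>

definition Lip :: "'a::metric_space set \<Rightarrow> ('a \<Rightarrow> real) set" where
  "Lip X = {f \<in> extensional X. \<exists>L. L-lipschitz_on X f}"

definition sup_norm :: "'a set \<Rightarrow> ('a \<Rightarrow> real) \<Rightarrow> real" where
  "sup_norm X f = (SUP x\<in>X. \<bar>f x\<bar>)"

definition lip_const :: "'a::metric_space set \<Rightarrow> ('a \<Rightarrow> real) \<Rightarrow> real" where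
  "lip_const X f = Inf {L. L-lipschitz_on X f}"

definition lip_norm :: "'a::metric_space set \<Rightarrow> ('a \<Rightarrow> real) \<Rightarrow> real" where
  "lip_norm X f = sup_norm X f + lip_const X f"

text \<open>
  The locale \<open>Metric_space\<close> requires the distance to be nonnegative and symmetric also off its
  carrier, which is the reason for the default value \<open>0\<close>.
\<close>

definition lip_dist :: "'a::metric_space set \<Rightarrow> ('a \<Rightarrow> real) \<Rightarrow> ('a \<Rightarrow> real) \<Rightarrow> real" where
  "lip_dist X f g = (if f \<in> Lip X \<and> g \<in> Lip X then lip_norm X (\<lambda>x. f x - g x) else 0)"

definition lip_topology :: "'a::metric_space set \<Rightarrow> ('a \<Rightarrow> real) topology" where
  "lip_topology X = Metric_space.mtopology (Lip X) (lip_dist X)"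

definition open_dense :: "'b topology \<Rightarrow> 'b set \<Rightarrow> bool" where
  "open_dense \<T> U \<longleftrightarrow> openin \<T> U \<and> \<T> closure_of U = topspace \<T>"

lemma lip_const_props:
  assumes "\<exists>L. L-lipschitz_on X f"
  shows "0 \<le> lip_const X f" and "\<And>L. L-lipschitz_on X f \<Longrightarrow> lip_const X f \<le> L"
proof -
  show "0 \<le> lip_const X f"
    unfolding lip_const_def using assms by (intro cInf_greatest) (auto dest: lipschitz_on_nonneg)
  show "lip_const X f \<le> L" if "L-lipschitz_on X f" for L
    unfolding lip_const_def
    using that by (intro cInf_lower) (auto intro!: bdd_belowI[of _ 0] dest: lipschitz_on_nonneg)
qed

lemma sup_norm_props:
  assumes "compact X" "X \<noteq> {}" "continuous_on X f"
  shows "0 \<le> sup_norm X f" and "\<And>x. x \<in> X \<Longrightarrow> \<bar>f x\<bar> \<le> sup_norm X f"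
proof -
  have "compact ((\<lambda>x. \<bar>f x\<bar>) ` X)"
    using assms by (intro compact_continuous_image continuous_intros)
  then have "bdd_above ((\<lambda>x. \<bar>f x\<bar>) ` X)"
    by (intro bounded_imp_bdd_above compact_imp_bounded)
  then show *: "\<bar>f x\<bar> \<le> sup_norm X f" if "x \<in> X" for x
    unfolding sup_norm_def using that by (rule cSUP_upper2) simp_all
  show "0 \<le> sup_norm X f"
    using assms(2) * by (meson abs_ge_zero all_not_in_conv order_trans)
qed

lemma Lip_diff: "f \<in> Lip X \<Longrightarrow> g \<in> Lip X \<Longrightarrow> \<exists>L. L-lipschitz_on X (\<lambda>x. f x - g x)"
  unfolding Lip_def by (blast intro: lipschitz_on_diff)

lemma Lip_diff_continuous: "f \<in> Lip X \<Longrightarrow> g \<in> Lip X \<Longrightarrow> continuous_on X (\<lambda>x. f x - g x)"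
  using Lip_diff lipschitz_on_continuous_on by metis

lemma Metric_space_Lip:
  assumes X: "compact X" "X \<noteq> {}"
  shows "Metric_space (Lip X) (lip_dist X)"
proof
  note cont = Lip_diff_continuous
  fix f g
  show "0 \<le> lip_dist X f g"
    unfolding lip_dist_def lip_norm_def
    by (auto intro!: add_nonneg_nonneg sup_norm_props(1)[OF X] lip_const_props(1) Lip_diff cont)
  have "L-lipschitz_on X (\<lambda>x. f x - g x) \<longleftrightarrow> L-lipschitz_on X (\<lambda>x. g x - f x)" for L
    using lipschitz_on_minus[of L X "\<lambda>x. f x - g x"] lipschitz_on_minus[of L X "\<lambda>x. g x - f x"]
    by auto
  then show "lip_dist X f g = lip_dist X g f"
    unfolding lip_dist_def lip_norm_def sup_norm_def lip_const_def
    by (simp add: abs_minus_commute)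
  show "lip_dist X f g = 0 \<longleftrightarrow> f = g" if fg: "f \<in> Lip X" "g \<in> Lip X"
  proof
    assume 0: "lip_dist X f g = 0"
    note nn = sup_norm_props(1)[OF X cont[OF fg]] lip_const_props(1)[OF Lip_diff[OF fg]]
    have "sup_norm X (\<lambda>x. f x - g x) = 0"
      using 0 fg nn by (simp add: lip_dist_def lip_norm_def)
    then have "f x = g x" if "x \<in> X" for x
      using sup_norm_props(2)[OF X cont[OF fg] that] by simp
    then show "f = g"
      using fg by (auto simp: Lip_def intro: extensionalityI)
  next
    assume "f = g"
    moreover have "0-lipschitz_on X (\<lambda>x. 0::real)"
      by (auto intro: lipschitz_onI)
    then have "lip_const X (\<lambda>x. 0) = 0"
      by (meson lip_const_props order_antisym)
    ultimately show "lip_dist X f g = 0"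
      using X by (simp add: lip_dist_def lip_norm_def sup_norm_def)
  qed
  fix h
  assume f: "f \<in> Lip X" and g: "g \<in> Lip X" and h: "h \<in> Lip X"
  let ?a = "\<lambda>x. f x - g x" and ?b = "\<lambda>x. g x - h x" and ?c = "\<lambda>x. f x - h x"
  have "sup_norm X ?c \<le> sup_norm X ?a + sup_norm X ?b"
    unfolding sup_norm_def[of X ?c]
  proof (rule cSUP_least[OF X(2)])
    fix x assume "x \<in> X"
    then show "\<bar>?c x\<bar> \<le> sup_norm X ?a + sup_norm X ?b"
      using sup_norm_props(2)[OF X cont[OF f g], of x] sup_norm_props(2)[OF X cont[OF g h], of x]
      by linarith
  qed
  moreover have "lip_const X ?c \<le> K + L" if "K-lipschitz_on X ?a" "L-lipschitz_on X ?b" for K L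
    using lip_const_props(2)[OF Lip_diff[OF f h]] lipschitz_on_add[OF that] by simp
  then have "lip_const X ?c - K \<le> lip_const X ?b" if "K-lipschitz_on X ?a" for K
    unfolding lip_const_def[of X ?b] using that Lip_diff[OF g h]
    by (intro cInf_greatest) (fastforce simp: algebra_simps)+
  then have "lip_const X ?c - lip_const X ?b \<le> lip_const X ?a"
    unfolding lip_const_def[of X ?a] using Lip_diff[OF f g]
    by (intro cInf_greatest) (fastforce simp: algebra_simps)+
  ultimately show "lip_dist X f h \<le> lip_dist X f g + lip_dist X g h"
    using f g h by (simp add: lip_dist_def lip_norm_def)
qed

lemma topspace_lip_topology:
  assumes "compact X" "X \<noteq> {}"
  shows "topspace (lip_topology X) = Lip X"
  unfolding lip_topology_def using Metric_space.topspace_mtopology[OF Metric_space_Lip[OF assms]] .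

definition almost_additive :: "'a::metric_space set \<Rightarrow> ('a \<Rightarrow> 'a) \<Rightarrow> (nat \<Rightarrow> 'a \<Rightarrow> real) \<Rightarrow> bool" where
  "almost_additive X T \<phi> \<longleftrightarrow>
     (\<forall>n\<ge>1. continuous_on X (\<phi> n)) \<and>
     (\<exists>C\<ge>0. \<forall>n\<ge>1. \<forall>m\<ge>1. sup_norm X (\<lambda>x. \<phi> (n + m) x - \<phi> n x - \<phi> m ((T ^^ n) x)) \<le> C)"

definition inv_measures :: "'a::metric_space set \<Rightarrow> ('a \<Rightarrow> 'a) \<Rightarrow> 'a measure set" where
  "inv_measures X T =
     {\<mu>. sets \<mu> = sets (restrict_space borel X) \<and> prob_space \<mu> \<and> distr \<mu> \<mu> T = \<mu>}"

text \<open>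
  The members of \<open>inv_measures X T\<close> supported on a closed set \<open>Z \<subseteq> X\<close>; as measures they still live
  on the Borel sets of \<open>X\<close>.
\<close>

definition inv_measures_on ::
    "'a::metric_space set \<Rightarrow> ('a \<Rightarrow> 'a) \<Rightarrow> 'a set \<Rightarrow> 'a measure set" where
  "inv_measures_on X T Z = {\<mu> \<in> inv_measures X T. emeasure \<mu> Z = 1}"

definition asymptotic_mean :: "(nat \<Rightarrow> 'a \<Rightarrow> real) \<Rightarrow> 'a measure \<Rightarrow> real" where
  "asymptotic_mean \<phi> \<mu> = lim (\<lambda>n. (1 / real n) * (\<integral>x. \<phi> n x \<partial>\<mu>))"

definition max_measures ::
    "'a::metric_space set \<Rightarrow> ('a \<Rightarrow> 'a) \<Rightarrow> (nat \<Rightarrow> 'a \<Rightarrow> real) \<Rightarrow> 'a measure set" where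
  "max_measures X T \<phi> =
     {\<mu> \<in> inv_measures X T. \<forall>\<nu>\<in>inv_measures X T. asymptotic_mean \<phi> \<nu> \<le> asymptotic_mean \<phi> \<mu>}"

definition perturb ::
    "('a \<Rightarrow> 'a) \<Rightarrow> (nat \<Rightarrow> 'a \<Rightarrow> real) \<Rightarrow> ('a \<Rightarrow> real) \<Rightarrow> nat \<Rightarrow> 'a \<Rightarrow> real" where
  "perturb T \<phi> f n x = \<phi> n x + (\<Sum>j<n. f ((T ^^ j) x))"

definition closed_invariant :: "'a::metric_space set \<Rightarrow> ('a \<Rightarrow> 'a) \<Rightarrow> 'a set \<Rightarrow> bool" where
  "closed_invariant X T Z \<longleftrightarrow> Z \<subseteq> X \<and> closed Z \<and> T ` Z \<subseteq> Z"

definition Lip_leaf ::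
    "'a::metric_space set \<Rightarrow> ('a \<Rightarrow> 'a) \<Rightarrow> (nat \<Rightarrow> 'a \<Rightarrow> real) \<Rightarrow> 'a set \<Rightarrow> ('a \<Rightarrow> real) set" where
  "Lip_leaf X T \<phi> Z = {f \<in> Lip X. max_measures X T (perturb T \<phi> f) \<inter> inv_measures_on X T Z \<noteq> {}}"

definition leafwise_maximizable ::
    "'a::metric_space set \<Rightarrow> ('a \<Rightarrow> 'a) \<Rightarrow> (nat \<Rightarrow> 'a \<Rightarrow> real) \<Rightarrow> 'a set set \<Rightarrow> bool" where
  "leafwise_maximizable X T \<phi> \<Z> \<longleftrightarrow> Lip X = (\<Union>Z\<in>\<Z>. Lip_leaf X T \<phi> Z)"

definition periodic_orbit :: "'a set \<Rightarrow> ('a \<Rightarrow> 'a) \<Rightarrow> 'a set \<Rightarrow> bool" where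
  "periodic_orbit X T Q \<longleftrightarrow>
     (\<exists>x\<in>X. \<exists>p\<ge>1. (T ^^ p) x = x \<and> Q = {(T ^^ j) x | j. j < p})"

definition orbit_measure :: "'a::metric_space set \<Rightarrow> 'a set \<Rightarrow> 'a measure" where
  "orbit_measure X Q = distr (uniform_count_measure Q) (restrict_space borel X) (\<lambda>x. x)"

definition uniquely_periodic ::
    "'a::metric_space set \<Rightarrow> ('a \<Rightarrow> 'a) \<Rightarrow> (nat \<Rightarrow> 'a \<Rightarrow> real) \<Rightarrow> ('a \<Rightarrow> real) \<Rightarrow> bool" where
  "uniquely_periodic X T \<phi> f \<longleftrightarrow>
     (\<exists>Q. periodic_orbit X T Q \<and> max_measures X T (perturb T \<phi> f) = {orbit_measure X Q})"

definition periodic_locus ::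
    "'a::metric_space set \<Rightarrow> ('a \<Rightarrow> 'a) \<Rightarrow> (nat \<Rightarrow> 'a \<Rightarrow> real) \<Rightarrow> ('a \<Rightarrow> real) set" where
  "periodic_locus X T \<phi> = lip_topology X interior_of {f \<in> Lip X. uniquely_periodic X T \<phi> f}"

definition relative_TPO ::
    "'a::metric_space set \<Rightarrow> ('a \<Rightarrow> 'a) \<Rightarrow> (nat \<Rightarrow> 'a \<Rightarrow> real) \<Rightarrow> bool" where
  "relative_TPO X T \<phi> \<longleftrightarrow>
     (\<exists>U. open_dense (lip_topology X) U \<and> (\<forall>f\<in>U. uniquely_periodic X T \<phi> f))"

end

(*
  By Baire's theorem it suffices to work near a function in the interior of one leaf Z. There every
  maximizing measure lives on Z: otherwise adding a small multiple of the distance to Z would push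
  the maximum off Z. Hence the maximizing measures of f on X are those of the restriction of f to Z,
  and a Lipschitz extension of small norm moves this restriction into the open dense set provided
  by the relative TPO property of Z.
*)
theory Submission imports Defs
begin

text \<open>Baire's theorem asks for closed pieces, and closedness of \<open>Lip_leaf\<close> would
  rest on weak-* compactness of the invariant measures. Each leaf is therefore enlarged to a closed
  set \<open>approx_leaf\<close>, in which measures on Z need only approach the supremum. At its
  interior points the enlargement adds nothing: there all maximizing measures are carried by Z, and
  one exists because the leaves cover \<open>Lip X\<close>. So maximizing measures always come from
  leafwise maximizability, never from a compactness argument. The sequence itself causes little
  trouble: perturbing by f changes the asymptotic mean of \<mu> by exactly the integral of f, so
  \<Phi> contributes a term independent of f that cancels in all comparisons of two functions.
  Almost additivity serves to make the limit defining the mean exist.\<close>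

section \<open>The space of Lipschitz functions\<close>

text \<open>The infimum is attained, since every difference quotient is a lower bound for the
  admissible constants.\<close>

lemma lip_const_lipschitz:
  fixes f :: "'a::metric_space \<Rightarrow> real"
  assumes "\<exists>L. L-lipschitz_on X f"
  shows "(lip_const X f)-lipschitz_on X f"
proof (rule lipschitz_onI)
  fix x y assume xy: "x \<in> X" "y \<in> X"
  show "dist (f x) (f y) \<le> lip_const X f * dist x y"
  proof (cases "x = y")
    case False
    have "dist (f x) (f y) / dist x y \<le> lip_const X f"
      unfolding lip_const_def using assms xy False
      by (intro cInf_greatest) (auto simp: divide_simps dest: lipschitz_onD)
    then show ?thesis
      using False by (simp add: divide_simps)
  qed simp
qed (rule lip_const_props(1)[OF assms])

lemma Lip_continuous: "f \<in> Lip X \<Longrightarrow> continuous_on X f"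
  unfolding Lip_def by (blast intro: lipschitz_on_continuous_on)

lemma Lip_restrictI: "L-lipschitz_on X f \<Longrightarrow> restrict f X \<in> Lip X"
  unfolding Lip_def by (simp add: exI[of _ L])

lemma lip_dist_le:
  assumes "X \<noteq> {}" "f \<in> Lip X" "g \<in> Lip X"
    and "L-lipschitz_on X (\<lambda>x. f x - g x)" "\<And>x. x \<in> X \<Longrightarrow> \<bar>f x - g x\<bar> \<le> M"
  shows "lip_dist X f g \<le> M + L"
proof -
  have "sup_norm X (\<lambda>x. f x - g x) \<le> M"
    unfolding sup_norm_def using assms by (intro cSUP_least) auto
  moreover have "lip_const X (\<lambda>x. f x - g x) \<le> L"
    using assms by (intro lip_const_props) auto
  ultimately show ?thesis
    using assms by (simp add: lip_dist_def lip_norm_def)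
qed

lemma lip_dist_bounds:
  assumes X: "compact X" "X \<noteq> {}" and fg: "f \<in> Lip X" "g \<in> Lip X"
  shows "x \<in> X \<Longrightarrow> \<bar>f x - g x\<bar> \<le> lip_dist X f g"
    and "(lip_dist X f g)-lipschitz_on X (\<lambda>x. f x - g x)"
proof -
  note s = sup_norm_props[OF X Lip_diff_continuous[OF fg]]
  note l = lip_const_props(1)[OF Lip_diff[OF fg]]
  show "\<bar>f x - g x\<bar> \<le> lip_dist X f g" if "x \<in> X"
    using s(2)[OF that] l fg by (simp add: lip_dist_def lip_norm_def)
  show "(lip_dist X f g)-lipschitz_on X (\<lambda>x. f x - g x)"
    using lip_const_lipschitz[OF Lip_diff[OF fg]] s(1) fg
    by (elim lipschitz_on_mono) (auto simp: lip_dist_def lip_norm_def)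
qed

text \<open>This is the completeness that Baire's theorem needs. The limit is taken pointwise, and
  the Cauchy estimates survive it.\<close>

lemma mcomplete_Lip:
  assumes X: "compact X" "X \<noteq> {}"
  shows "Metric_space.mcomplete (Lip X) (lip_dist X)"
proof -
  interpret Metric_space "Lip X" "lip_dist X"
    by (rule Metric_space_Lip[OF X])
  show ?thesis
    unfolding mcomplete_def
  proof (intro allI impI)
    fix \<sigma> assume "MCauchy \<sigma>"
    then have \<sigma>: "\<sigma> n \<in> Lip X" for n
      by (auto simp: MCauchy_def)
    have C: "\<And>e. e > 0 \<Longrightarrow> \<exists>N. \<forall>n n'. N \<le> n \<longrightarrow> N \<le> n' \<longrightarrow> lip_dist X (\<sigma> n) (\<sigma> n') < e"
      using \<open>MCauchy \<sigma>\<close> by (auto simp: MCauchy_def)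
    have "convergent (\<lambda>n. \<sigma> n x)" if "x \<in> X" for x
    proof (rule real_Cauchy_convergent, rule metric_CauchyI)
      fix e :: real assume "e > 0"
      then obtain N where N: "\<And>n n'. N \<le> n \<Longrightarrow> N \<le> n' \<Longrightarrow> lip_dist X (\<sigma> n) (\<sigma> n') < e"
        using C by blast
      have "dist (\<sigma> m x) (\<sigma> n x) < e" if "m \<ge> N" "n \<ge> N" for m n
        using N[OF that] lip_dist_bounds(1)[OF X \<sigma> \<sigma> \<open>x \<in> X\<close>, of m n] by (simp add: dist_real_def)
      then show "\<exists>M. \<forall>m\<ge>M. \<forall>n\<ge>M. dist (\<sigma> m x) (\<sigma> n x) < e"
        by blast
    qed
    then obtain g where g: "(\<lambda>n. \<sigma> n x) \<longlonglongrightarrow> g x" if "x \<in> X" for x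
      unfolding convergent_def by metis
    \<comment> \<open>The Cauchy estimate with the second index sent to infinity. It is phrased
      without \<open>lip_dist\<close> because \<open>g\<close> is not yet known to be
      Lipschitz.\<close>
    have key: "\<exists>N. \<forall>n\<ge>N. e-lipschitz_on X (\<lambda>x. \<sigma> n x - g x) \<and> (\<forall>x\<in>X. \<bar>\<sigma> n x - g x\<bar> \<le> e)"
      if e: "e > 0" for e :: real
    proof -
      obtain N where N: "\<And>n n'. N \<le> n \<Longrightarrow> N \<le> n' \<Longrightarrow> lip_dist X (\<sigma> n) (\<sigma> n') < e"
        using C e by blast
      have "e-lipschitz_on X (\<lambda>x. \<sigma> n x - g x)" if n: "n \<ge> N" for n
      proof (rule lipschitz_onI)
        fix x y assume xy: "x \<in> X" "y \<in> X"
        have "\<bar>(\<sigma> n x - \<sigma> m x) - (\<sigma> n y - \<sigma> m y)\<bar> \<le> e * dist x y" if "m \<ge> N" for m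
          using lipschitz_onD[OF lip_dist_bounds(2)[OF X \<sigma> \<sigma>] xy, of n m] N[OF n that]
          by (smt (verit) dist_real_def mult_right_mono zero_le_dist)
        then show "dist (\<sigma> n x - g x) (\<sigma> n y - g y) \<le> e * dist x y"
          unfolding dist_real_def
          by (intro tendsto_upperbound[OF tendsto_rabs[OF tendsto_diff[OF
                tendsto_diff[OF tendsto_const g[OF xy(1)]] tendsto_diff[OF tendsto_const g[OF xy(2)]]]]])
            (auto intro: eventually_sequentiallyI[of N])
      qed (use e in simp)
      moreover have "\<bar>\<sigma> n x - g x\<bar> \<le> e" if n: "n \<ge> N" and x: "x \<in> X" for n x
      proof (rule tendsto_upperbound[where f = "\<lambda>m. \<bar>\<sigma> n x - \<sigma> m x\<bar>"])
        show "(\<lambda>m. \<bar>\<sigma> n x - \<sigma> m x\<bar>) \<longlonglongrightarrow> \<bar>\<sigma> n x - g x\<bar>"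
          by (intro tendsto_intros g x)
        show "\<forall>\<^sub>F m in sequentially. \<bar>\<sigma> n x - \<sigma> m x\<bar> \<le> e"
          using N[OF n] lip_dist_bounds(1)[OF X \<sigma> \<sigma> x, of n]
          by (intro eventually_sequentiallyI[of N]) (meson less_imp_le order_trans)
      qed simp
      ultimately show ?thesis
        by blast
    qed
    \<comment> \<open>On X, \<open>g\<close> is \<open>\<sigma> n\<close> minus the Lipschitz
      remainder from \<open>key\<close>; \<open>restrict\<close> supplies the default value off X
      that \<open>Lip\<close> demands.\<close>
    have gL: "restrict g X \<in> Lip X"
    proof -
      obtain n where "1-lipschitz_on X (\<lambda>x. \<sigma> n x - g x)"
        using key[of 1] by auto
      moreover obtain L where "L-lipschitz_on X (\<sigma> n)"
        using \<sigma> by (auto simp: Lip_def)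
      ultimately have "(L + 1)-lipschitz_on X (\<lambda>x. \<sigma> n x - (\<sigma> n x - g x))"
        by (intro lipschitz_on_diff)
      then show ?thesis
        by (intro Lip_restrictI[of "L + 1"]) simp
    qed
    have "\<exists>N. \<forall>n\<ge>N. \<sigma> n \<in> Lip X \<and> lip_dist X (\<sigma> n) (restrict g X) < e" if e: "e > 0" for e
    proof -
      \<comment> \<open>Sup part and Lipschitz part cost \<open>e/3\<close> each, which leaves room
        for the strict inequality.\<close>
      obtain N where N: "\<And>n. n \<ge> N \<Longrightarrow> (e/3)-lipschitz_on X (\<lambda>x. \<sigma> n x - g x)"
          "\<And>n x. n \<ge> N \<Longrightarrow> x \<in> X \<Longrightarrow> \<bar>\<sigma> n x - g x\<bar> \<le> e/3"
        using key[of "e/3"] e by auto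
      have "lip_dist X (\<sigma> n) (restrict g X) \<le> e/3 + e/3" if "n \<ge> N" for n
        using N[OF that] by (intro lip_dist_le X \<sigma> gL) auto
      then show ?thesis
        using e \<sigma> by (intro exI[of _ N]) fastforce
    qed
    then have "limitin mtopology \<sigma> (restrict g X) sequentially"
      unfolding limit_metric_sequentially using gL by blast
    then show "\<exists>g. limitin mtopology \<sigma> g sequentially"
      by blast
  qed
qed

section \<open>Extending Lipschitz functions from a subset\<close>

lemma lipschitz_extension:
  fixes f :: "'a::metric_space \<Rightarrow> real"
  assumes Z: "Z \<noteq> {}" and f: "L-lipschitz_on Z f"
  obtains g where "L-lipschitz_on UNIV g" "\<And>z. z \<in> Z \<Longrightarrow> g z = f z"
proof
  \<comment> \<open>McShane's formula: the lower envelope of the upward cones of slope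
    \<open>L\<close> over the graph of \<open>f\<close>. Each cone is L-Lipschitz in
    \<open>x\<close>, and so is their infimum.\<close>
  define g where "g x = (INF z\<in>Z. f z + L * dist x z)" for x
  have L: "L \<ge> 0"
    using f lipschitz_on_nonneg by blast
  have fz: "f z \<le> f w + L * dist z w" if "z \<in> Z" "w \<in> Z" for z w
    using lipschitz_onD[OF f that] by (simp add: dist_real_def)
  \<comment> \<open>The downward cone at a single point \<open>w\<close> lies below all upward
    cones, so the real infimum is meaningful.\<close>
  have bdd: "bdd_below ((\<lambda>z. f z + L * dist x z) ` Z)" for x
  proof -
    obtain w where w: "w \<in> Z"
      using Z by blast
    have "f w - L * dist x w \<le> f z + L * dist x z" if "z \<in> Z" for z
    proof -
      have "f w \<le> f z + L * (dist x w + dist x z)"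
        using fz[OF w that] mult_left_mono[OF dist_triangle3[of w z x] L] by linarith
      then show ?thesis
        by (simp add: algebra_simps)
    qed
    then show ?thesis
      by (auto intro!: bdd_belowI2)
  qed
  have le: "g x \<le> g y + L * dist x y" for x y
  proof -
    have "g x - L * dist x y \<le> f z + L * dist y z" if "z \<in> Z" for z
    proof -
      have "g x \<le> f z + L * dist x z"
        unfolding g_def by (rule cINF_lower[OF bdd that])
      moreover have "L * dist x z \<le> L * (dist x y + dist y z)"
        by (intro mult_left_mono dist_triangle L)
      ultimately show ?thesis
        by (simp add: algebra_simps)
    qed
    then have "g x - L * dist x y \<le> g y"
      unfolding g_def[of y] by (intro cINF_greatest Z)
    then show ?thesis
      by simp
  qed
  show "L-lipschitz_on UNIV g"
  proof (rule lipschitz_onI[OF _ L])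
    fix x y show "dist (g x) (g y) \<le> L * dist x y"
      using le[of x y] le[of y x] by (simp add: dist_real_def dist_commute)
  qed
  fix z assume z: "z \<in> Z"
  have "g z \<le> f z"
    unfolding g_def using cINF_lower[OF bdd z, of z] by simp
  moreover have "f z \<le> g z"
    unfolding g_def using fz z by (intro cINF_greatest Z)
  ultimately show "g z = f z"
    by simp
qed

lemma Lip_restrict_subset:
  assumes "f \<in> Lip X" "Z \<subseteq> X"
  shows "restrict f Z \<in> Lip Z"
proof -
  obtain L where "L-lipschitz_on X f"
    using assms by (auto simp: Lip_def)
  from Lip_restrictI[OF lipschitz_on_subset[OF this assms(2)]] show ?thesis .
qed

text \<open>The factor 2 arises because the sup part and the Lipschitz part are each bounded by the
  whole distance on X.\<close>

lemma lip_dist_restrict_le: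
  assumes X: "compact X" "Z \<noteq> {}" "Z \<subseteq> X" and fg: "f \<in> Lip X" "g \<in> Lip X"
  shows "lip_dist Z (restrict f Z) (restrict g Z) \<le> 2 * lip_dist X f g"
proof -
  have "X \<noteq> {}"
    using X by blast
  note b = lip_dist_bounds[OF X(1) this fg]
  have "lip_dist Z (restrict f Z) (restrict g Z) \<le> lip_dist X f g + lip_dist X f g"
    using b(1) X lipschitz_on_subset[OF b(2) X(3)]
    by (intro lip_dist_le Lip_restrict_subset[OF _ X(3)] fg) auto
  then show ?thesis
    by simp
qed

text \<open>Not the approximant \<open>v\<close> but its difference from \<open>f\<close> on Z is
  extended: the difference has a small Lipschitz constant, and the extension keeps that
  constant.\<close>

lemma Lip_approximate_extension:
  assumes X: "compact X" "compact Z" "Z \<noteq> {}" "Z \<subseteq> X" and f: "f \<in> Lip X"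
    and V: "lip_topology Z closure_of V = Lip Z" and r: "r > 0"
  obtains g where "g \<in> Lip X" "lip_dist X f g < r" "restrict g Z \<in> V"
proof -
  interpret Z: Metric_space "Lip Z" "lip_dist Z"
    by (rule Metric_space_Lip[OF X(2,3)])
  have ne: "X \<noteq> {}"
    using X by blast
  obtain D where D: "\<And>x y. x \<in> X \<Longrightarrow> y \<in> X \<Longrightarrow> dist x y \<le> D"
    using compact_imp_bounded[OF X(1)] unfolding bounded_two_points by metis
  have D0: "D \<ge> 0"
    using D ne by (metis all_not_in_conv dist_self)
  \<comment> \<open>The correction \<open>k\<close> will have norm at most
    \<open>(d + d * D) + d = d * (D + 2)\<close>; the 3 in place of 2 makes the final bound by
    \<open>r\<close> strict.\<close>
  define d where "d = r / (D + 3)"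
  have d: "d > 0"
    using r D0 by (simp add: d_def)
  have fZ: "restrict f Z \<in> Lip Z"
    by (rule Lip_restrict_subset[OF f X(4)])
  then obtain v where v: "v \<in> V" "v \<in> Lip Z" and dv: "lip_dist Z (restrict f Z) v < d"
    using V d unfolding lip_topology_def Z.metric_closure_of by (auto simp: Z.in_mball)
  note b = lip_dist_bounds[OF X(2,3) v(2) fZ]
  have dv': "lip_dist Z v (restrict f Z) \<le> d"
    using dv Z.commute by simp
  obtain k where k: "d-lipschitz_on UNIV k" and kz: "\<And>z. z \<in> Z \<Longrightarrow> k z = v z - restrict f Z z"
    using lipschitz_extension[OF X(3) lipschitz_on_mono[OF b(2) order_refl dv']] by metis
  have kX: "d-lipschitz_on X k"
    using k by (rule lipschitz_on_subset) simp
  define g where "g = restrict (\<lambda>x. f x + k x) X"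
  obtain L where "L-lipschitz_on X f"
    using f by (auto simp: Lip_def)
  then have g: "g \<in> Lip X"
    unfolding g_def by (rule Lip_restrictI[OF lipschitz_on_add[OF _ kX]])
  obtain z where z: "z \<in> Z"
    using X by blast
  \<comment> \<open>The extension controls only slopes. The sup bound comes from anchoring at
    \<open>z\<close> in Z, where \<open>k\<close> is at most \<open>d\<close>, and from the bound
    \<open>D\<close> on distances in X.\<close>
  have "\<bar>k x\<bar> \<le> d + d * D" if "x \<in> X" for x
  proof -
    have "\<bar>k z\<bar> \<le> d"
      using b(1)[OF z] kz[OF z] dv' by simp
    moreover have "\<bar>k x - k z\<bar> \<le> d * dist x z"
      using lipschitz_onD[OF k, of x z] by (simp add: dist_real_def)
    moreover have "d * dist x z \<le> d * D"
      using D[of x z] that z X d by (intro mult_left_mono) auto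
    ultimately show ?thesis
      by linarith
  qed
  then have "lip_dist X g f \<le> (d + d * D) + d"
    using kX by (intro lip_dist_le ne g f) (auto simp: g_def)
  also have "\<dots> < d * (D + 3)"
    using d by (simp add: algebra_simps)
  also have "\<dots> = r"
    using D0 by (simp add: d_def)
  finally have "lip_dist X f g < r"
    using Metric_space.commute[OF Metric_space_Lip[OF X(1) ne]] by metis
  moreover have "restrict g Z = v"
    using v(2) X(4) kz by (intro extensionalityI[where A = Z]) (auto simp: g_def Lip_def)
  ultimately show thesis
    using that g v by blast
qed

section \<open>Invariant measures and asymptotic means\<close>

text \<open>The averages at \<open>n\<close> and \<open>m\<close> are both compared with the average
  at the common multiple \<open>m * n\<close>. Passing from \<open>n\<close> to a multiple costs at
  most \<open>C / n\<close>, whatever the multiplier.\<close>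

lemma convergent_almost_additive_average:
  fixes a :: "nat \<Rightarrow> real"
  assumes aa: "\<And>n m. n \<ge> 1 \<Longrightarrow> m \<ge> 1 \<Longrightarrow> \<bar>a (n + m) - a n - a m\<bar> \<le> C"
  shows "convergent (\<lambda>n. a n / real n)"
proof (rule real_Cauchy_convergent, rule metric_CauchyI)
  have C: "C \<ge> 0"
    using aa[of 1 1] by simp
  have mult: "\<bar>a (k * n) - real k * a n\<bar> \<le> real k * C" if "k \<ge> 1" "n \<ge> 1" for k n
    using \<open>k \<ge> 1\<close>
  proof (induction k rule: dec_induct)
    case base
    then show ?case
      using C by simp
  next
    case (step k)
    then have "\<bar>a (k * n + n) - a (k * n) - a n\<bar> \<le> C"
      using that by (intro aa) auto
    with step.IH show ?case
      by (simp add: algebra_simps)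
  qed
  have close: "\<bar>a (k * n) / real (k * n) - a n / real n\<bar> \<le> C / real n" if "k \<ge> 1" "n \<ge> 1" for k n
  proof -
    have "a (k * n) / real (k * n) - a n / real n = (a (k * n) - real k * a n) / real (k * n)"
      using that by (simp add: field_simps)
    then have "\<bar>a (k * n) / real (k * n) - a n / real n\<bar> = \<bar>a (k * n) - real k * a n\<bar> / real (k * n)"
      by (simp add: abs_divide)
    also have "\<dots> \<le> real k * C / real (k * n)"
      by (intro divide_right_mono mult that) simp
    finally show ?thesis
      using that by simp
  qed
  fix e :: real assume e: "e > 0"
  \<comment> \<open>Makes each of the two errors less than \<open>e / 2\<close>; the later
    \<open>max 1 N\<close> excludes the index 0.\<close>
  obtain N where N: "real N > 2 * C / e"
    using reals_Archimedean2 by blast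
  have "dist (a n / real n) (a m / real m) < e" if "n \<ge> max 1 N" "m \<ge> max 1 N" for n m
  proof -
    have small: "C / real k < e / 2" if "k \<ge> max 1 N" for k
    proof -
      have "real k > 2 * C / e"
        using N that by simp
      then show ?thesis
        using e that by (simp add: field_simps)
    qed
    have "\<bar>a (m * n) / real (m * n) - a n / real n\<bar> \<le> C / real n"
      "\<bar>a (m * n) / real (m * n) - a m / real m\<bar> \<le> C / real m"
      using close[of m n] close[of n m] that by (simp_all add: mult.commute)
    then show ?thesis
      using small[OF that(1)] small[OF that(2)] unfolding dist_real_def by linarith
  qed
  then show "\<exists>M. \<forall>m\<ge>M. \<forall>n\<ge>M. dist (a m / real m) (a n / real n) < e"
    by blast
qed

text \<open>Bundled so that a non-empty closed invariant Z, with the same \<open>T\<close> and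
  \<open>\<phi>\<close>, becomes a second instance and inherits every fact below.\<close>

locale almost_additive_system =
  fixes X :: "'a::metric_space set" and T :: "'a \<Rightarrow> 'a" and \<phi> :: "nat \<Rightarrow> 'a \<Rightarrow> real"
  assumes compact: "compact X" and nonempty: "X \<noteq> {}"
    and continuous: "continuous_on X T" and maps: "T ` X \<subseteq> X"
    and almost_additive: "almost_additive X T \<phi>"
begin

lemma funpow_in: "x \<in> X \<Longrightarrow> (T ^^ n) x \<in> X"
  using maps by (induction n) auto

lemma continuous_funpow: "continuous_on X (T ^^ n)"
proof (induction n)
  case (Suc n)
  then show ?case
    using funpow_in continuous_on_compose2[OF continuous, of X "T ^^ n"] by (auto simp: image_subset_iff)
qed auto

lemma continuous_observable: "n \<ge> 1 \<Longrightarrow> continuous_on X (\<phi> n)"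
  using almost_additive by (simp add: almost_additive_def)

lemma continuous_defect:
  assumes "n \<ge> 1" "m \<ge> 1"
  shows "continuous_on X (\<lambda>x. \<phi> (n + m) x - \<phi> n x - \<phi> m ((T ^^ n) x))"
proof -
  have "continuous_on X (\<lambda>x. \<phi> m ((T ^^ n) x))"
    using assms(2) funpow_in
    by (intro continuous_on_compose2[OF continuous_observable continuous_funpow]) auto
  then show ?thesis
    using assms by (intro continuous_on_diff continuous_observable) auto
qed

text \<open>\<open>almost_additive\<close> bounds a real supremum, which controls the values because
  the defect is continuous on a compact set.\<close>

lemma defect_bound:
  obtains C where "\<And>n m x. n \<ge> 1 \<Longrightarrow> m \<ge> 1 \<Longrightarrow> x \<in> X \<Longrightarrow>
    \<bar>\<phi> (n + m) x - \<phi> n x - \<phi> m ((T ^^ n) x)\<bar> \<le> C"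
proof -
  obtain C where "\<And>n m. n \<ge> 1 \<Longrightarrow> m \<ge> 1 \<Longrightarrow>
      sup_norm X (\<lambda>x. \<phi> (n + m) x - \<phi> n x - \<phi> m ((T ^^ n) x)) \<le> C"
    using almost_additive unfolding almost_additive_def by blast
  then show thesis
    by (intro that order_trans[OF sup_norm_props(2)[OF compact nonempty continuous_defect]])
qed

lemma subsystem:
  assumes "Z \<noteq> {}" "closed_invariant X T Z"
  shows "almost_additive_system Z T \<phi>"
proof -
  have Z: "Z \<subseteq> X" "closed Z" "T ` Z \<subseteq> Z"
    using assms by (auto simp: closed_invariant_def)
  obtain C where C: "\<And>n m x. n \<ge> 1 \<Longrightarrow> m \<ge> 1 \<Longrightarrow> x \<in> X \<Longrightarrow>
      \<bar>\<phi> (n + m) x - \<phi> n x - \<phi> m ((T ^^ n) x)\<bar> \<le> C"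
    using defect_bound by blast
  have C0: "C \<ge> 0"
    using C[of 1 1] nonempty by (meson abs_ge_zero all_not_in_conv order_refl order_trans)
  show ?thesis
  proof
    show "compact Z"
      using Z compact by (metis compact_Int_closed inf.absorb2)
    show "continuous_on Z T"
      using Z continuous continuous_on_subset by blast
    have "sup_norm Z (\<lambda>x. \<phi> (n + m) x - \<phi> n x - \<phi> m ((T ^^ n) x)) \<le> C" if "n \<ge> 1" "m \<ge> 1" for n m
      unfolding sup_norm_def using C[OF that] Z assms by (intro cSUP_least) auto
    then show "almost_additive Z T \<phi>"
      unfolding almost_additive_def using C0 continuous_observable Z continuous_on_subset by blast
  qed (use assms Z in auto)
qed

lemma inv_measures_space: "\<mu> \<in> inv_measures X T \<Longrightarrow> space \<mu> = X"
  using sets_eq_imp_space_eq[of \<mu> "restrict_space borel X"]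
  by (simp add: inv_measures_def space_restrict_space)

lemma inv_measures_measurable:
  fixes g :: "'a \<Rightarrow> 'b::topological_space"
  assumes "\<mu> \<in> inv_measures X T" "continuous_on X g"
  shows "g \<in> borel_measurable \<mu>"
proof -
  have "measurable \<mu> borel = measurable (restrict_space borel X) (borel :: 'b measure)"
    using assms by (intro measurable_cong_sets) (auto simp: inv_measures_def)
  then show ?thesis
    using borel_measurable_continuous_on_restrict[OF assms(2)] by simp
qed

lemma inv_measures_measurable_funpow:
  assumes "\<mu> \<in> inv_measures X T"
  shows "T ^^ n \<in> measurable \<mu> \<mu>"
proof -
  have "T ^^ n \<in> measurable \<mu> (restrict_space borel X)"
    using inv_measures_measurable[OF assms continuous_funpow] funpow_in inv_measures_space[OF assms]
    by (intro measurable_restrict_space2) auto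
  moreover have "measurable \<mu> (restrict_space borel X) = measurable \<mu> \<mu>"
    using assms by (intro measurable_cong_sets) (auto simp: inv_measures_def)
  ultimately show ?thesis
    by simp
qed

lemma inv_measures_integrable:
  fixes g :: "'a \<Rightarrow> real"
  assumes \<mu>: "\<mu> \<in> inv_measures X T" and g: "continuous_on X g"
  shows "integrable \<mu> g"
proof -
  interpret prob_space \<mu>
    using \<mu> by (simp add: inv_measures_def)
  show ?thesis
    using sup_norm_props(2)[OF compact nonempty g] inv_measures_space[OF \<mu>]
    by (intro integrable_const_bound[where B = "sup_norm X g"] inv_measures_measurable[OF \<mu> g]) auto
qed

lemma integral_funpow:
  fixes g :: "'a \<Rightarrow> real"
  assumes \<mu>: "\<mu> \<in> inv_measures X T" and g: "continuous_on X g"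
  shows "(\<integral>x. g ((T ^^ n) x) \<partial>\<mu>) = (\<integral>x. g x \<partial>\<mu>)"
proof (induction n)
  case (Suc n)
  have gn: "continuous_on X (\<lambda>x. g ((T ^^ n) x))"
    using funpow_in by (intro continuous_on_compose2[OF g continuous_funpow]) auto
  have "(\<integral>x. g ((T ^^ n) x) \<partial>\<mu>) = (\<integral>x. g ((T ^^ n) x) \<partial>distr \<mu> \<mu> T)"
    using \<mu> by (simp add: inv_measures_def)
  also have "\<dots> = (\<integral>x. g ((T ^^ n) (T x)) \<partial>\<mu>)"
    using inv_measures_measurable_funpow[OF \<mu>, of 1] inv_measures_measurable[OF \<mu> gn]
    by (intro integral_distr) simp_all
  finally show ?case
    using Suc by (simp add: funpow_swap1)
qed simp

text \<open>By invariance, integrating the defect removes the iterate of \<open>T\<close>, so the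
  integrals form an almost additive real sequence. Convergence gives meaning to the total operator
  \<open>lim\<close> in \<open>asymptotic_mean\<close>.\<close>

lemma convergent_asymptotic_mean:
  assumes \<mu>: "\<mu> \<in> inv_measures X T"
  shows "convergent (\<lambda>n. (1 / real n) * (\<integral>x. \<phi> n x \<partial>\<mu>))"
proof -
  interpret prob_space \<mu>
    using \<mu> by (simp add: inv_measures_def)
  obtain C where C: "\<And>n m x. n \<ge> 1 \<Longrightarrow> m \<ge> 1 \<Longrightarrow> x \<in> X \<Longrightarrow>
      \<bar>\<phi> (n + m) x - \<phi> n x - \<phi> m ((T ^^ n) x)\<bar> \<le> C"
    using defect_bound by blast
  have "convergent (\<lambda>n. (\<integral>x. \<phi> n x \<partial>\<mu>) / real n)"
  proof (rule convergent_almost_additive_average)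
    fix n m :: nat assume nm: "n \<ge> 1" "m \<ge> 1"
    let ?D = "\<lambda>x. \<phi> (n + m) x - \<phi> n x - \<phi> m ((T ^^ n) x)"
    have cm: "continuous_on X (\<lambda>x. \<phi> m ((T ^^ n) x))"
      using nm funpow_in
      by (intro continuous_on_compose2[OF continuous_observable continuous_funpow]) auto
    note int = inv_measures_integrable[OF \<mu>]
    have "(\<integral>x. ?D x \<partial>\<mu>) = (\<integral>x. \<phi> (n + m) x \<partial>\<mu>) - (\<integral>x. \<phi> n x \<partial>\<mu>) - (\<integral>x. \<phi> m x \<partial>\<mu>)"
      using nm int cm continuous_observable integral_funpow[OF \<mu> continuous_observable[OF nm(2)]]
      by (simp add: Bochner_Integration.integral_diff Bochner_Integration.integrable_diff)
    moreover have "\<bar>\<integral>x. ?D x \<partial>\<mu>\<bar> \<le> C"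
    proof -
      have "\<bar>\<integral>x. ?D x \<partial>\<mu>\<bar> \<le> (\<integral>x. \<bar>?D x\<bar> \<partial>\<mu>)"
        by (rule integral_abs_bound)
      also have "\<dots> \<le> C"
        using C[OF nm] inv_measures_space[OF \<mu>] int[OF continuous_defect[OF nm]]
        by (intro integral_le_const integrable_abs) auto
      finally show ?thesis .
    qed
    ultimately show "\<bar>(\<integral>x. \<phi> (n + m) x \<partial>\<mu>) - (\<integral>x. \<phi> n x \<partial>\<mu>) - (\<integral>x. \<phi> m x \<partial>\<mu>)\<bar> \<le> C"
      by simp
  qed
  then show ?thesis
    by simp
qed

lemma asymptotic_mean_perturb:
  assumes \<mu>: "\<mu> \<in> inv_measures X T" and f: "continuous_on X f"
  shows "asymptotic_mean (perturb T \<phi> f) \<mu> = asymptotic_mean \<phi> \<mu> + (\<integral>x. f x \<partial>\<mu>)"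
proof -
  note int = inv_measures_integrable[OF \<mu>]
  have fj: "continuous_on X (\<lambda>x. f ((T ^^ j) x))" for j
    using funpow_in by (intro continuous_on_compose2[OF f continuous_funpow]) auto
  have "(\<integral>x. perturb T \<phi> f n x \<partial>\<mu>) = (\<integral>x. \<phi> n x \<partial>\<mu>) + real n * (\<integral>x. f x \<partial>\<mu>)" if "n \<ge> 1" for n
    unfolding perturb_def
    using int[OF continuous_observable[OF that]] int[OF fj] integral_funpow[OF \<mu> f] by simp
  \<comment> \<open>Equality is only eventual: at \<open>n = 0\<close> the right side is 0 while the
    left side is the integral of \<open>f\<close>.\<close>
  then have "\<forall>\<^sub>F n in sequentially. (1 / real n) * (\<integral>x. \<phi> n x \<partial>\<mu>) + (\<integral>x. f x \<partial>\<mu>)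
      = (1 / real n) * (\<integral>x. perturb T \<phi> f n x \<partial>\<mu>)"
    by (intro eventually_sequentiallyI[of 1]) (simp add: field_simps)
  moreover have "(\<lambda>n. (1 / real n) * (\<integral>x. \<phi> n x \<partial>\<mu>) + (\<integral>x. f x \<partial>\<mu>))
      \<longlonglongrightarrow> asymptotic_mean \<phi> \<mu> + (\<integral>x. f x \<partial>\<mu>)"
    using convergent_asymptotic_mean[OF \<mu>] unfolding asymptotic_mean_def convergent_LIMSEQ_iff
    by (intro tendsto_add tendsto_const)
  ultimately have "(\<lambda>n. (1 / real n) * (\<integral>x. perturb T \<phi> f n x \<partial>\<mu>))
      \<longlonglongrightarrow> asymptotic_mean \<phi> \<mu> + (\<integral>x. f x \<partial>\<mu>)"
    by (rule Lim_transform_eventually[rotated])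
  then show ?thesis
    unfolding asymptotic_mean_def[of "perturb T \<phi> f"] by (rule limI)
qed

text \<open>The asymptotic mean of the perturbed sequence, written so that its affine dependence on
  \<open>f\<close> is visible.\<close>

definition mean :: "('a \<Rightarrow> real) \<Rightarrow> 'a measure \<Rightarrow> real" where
  "mean f \<mu> = asymptotic_mean \<phi> \<mu> + (\<integral>x. f x \<partial>\<mu>)"

lemma max_measures_perturb_iff:
  assumes "f \<in> Lip X"
  shows "\<mu> \<in> max_measures X T (perturb T \<phi> f) \<longleftrightarrow>
    \<mu> \<in> inv_measures X T \<and> (\<forall>\<nu>\<in>inv_measures X T. mean f \<nu> \<le> mean f \<mu>)"
proof -
  have "asymptotic_mean (perturb T \<phi> f) \<nu> = mean f \<nu>" if "\<nu> \<in> inv_measures X T" for \<nu>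
    unfolding mean_def by (rule asymptotic_mean_perturb[OF that Lip_continuous[OF assms]])
  then show ?thesis
    unfolding max_measures_def by auto
qed

text \<open>The term from \<open>\<phi>\<close> cancels, leaving the integral of
  \<open>f - g\<close>. The bound is uniform in the measure, which the closedness of
  \<open>approx_leaf\<close> exploits.\<close>

lemma mean_diff_le:
  assumes \<mu>: "\<mu> \<in> inv_measures X T" and fg: "f \<in> Lip X" "g \<in> Lip X"
  shows "\<bar>mean f \<mu> - mean g \<mu>\<bar> \<le> lip_dist X f g"
proof -
  interpret prob_space \<mu>
    using \<mu> by (simp add: inv_measures_def)
  note int = inv_measures_integrable[OF \<mu>]
  have "mean f \<mu> - mean g \<mu> = (\<integral>x. f x - g x \<partial>\<mu>)"
    unfolding mean_def
    using int[OF Lip_continuous[OF fg(1)]] int[OF Lip_continuous[OF fg(2)]]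
    by (subst Bochner_Integration.integral_diff) simp_all
  also have "\<bar>\<dots>\<bar> \<le> (\<integral>x. \<bar>f x - g x\<bar> \<partial>\<mu>)"
    by (rule integral_abs_bound)
  also have "\<dots> \<le> lip_dist X f g"
    using lip_dist_bounds(1)[OF compact nonempty fg] inv_measures_space[OF \<mu>] int[OF Lip_diff_continuous[OF fg]]
    by (intro integral_le_const integrable_abs) auto
  finally show ?thesis .
qed

end

section \<open>Invariant measures of a subsystem and measures carried by Z\<close>

lemma emeasure_Int_full:
  assumes "prob_space \<mu>" "Z \<in> sets \<mu>" "emeasure \<mu> Z = 1" "A \<in> sets \<mu>"
  shows "emeasure \<mu> (A \<inter> Z) = emeasure \<mu> A"
proof -
  interpret prob_space \<mu>
    by fact
  have "AE x in \<mu>. x \<in> Z"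
    using assms by (intro AE_prob_1) (simp add: measure_def)
  then show ?thesis
    using assms by (intro emeasure_eq_AE) auto
qed

lemma (in almost_additive_system) measurable_restrict_borel:
  "T \<in> measurable (restrict_space borel X) (restrict_space borel X)"
  using maps by (intro measurable_restrict_space2 borel_measurable_continuous_on_restrict continuous)
    (auto simp: space_restrict_space)

locale almost_additive_subsystem = almost_additive_system +
  fixes Z :: "'a set"
  assumes Z_ne: "Z \<noteq> {}" and Z_inv: "closed_invariant X T Z"
begin

sublocale Z: almost_additive_system Z T \<phi>
  by (rule subsystem[OF Z_ne Z_inv])

lemma Z_sub: "Z \<subseteq> X" and Z_closed: "closed Z"
  using Z_inv by (auto simp: closed_invariant_def)

lemma Z_in_sets: "Z \<in> sets (restrict_space borel X)"
  using Z_sub Z_closed unfolding sets_restrict_space by (intro image_eqI[of _ _ Z]) auto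

text \<open>Push-forward under the inclusion of Z into X. Measures of the subsystem and measures on
  X carried by Z have different sigma-algebras, so they are matched by a map instead of being
  equal.\<close>

definition extend_measure :: "'a measure \<Rightarrow> 'a measure" where
  "extend_measure \<nu> = distr \<nu> (restrict_space borel X) (\<lambda>x. x)"

lemma measurable_inclusion:
  assumes "sets \<nu> = sets (restrict_space borel Z)"
  shows "(\<lambda>x. x) \<in> measurable \<nu> (restrict_space borel X)"
proof -
  have "(\<lambda>x. x) \<in> measurable (restrict_space borel Z) (restrict_space borel X)"
    using Z_sub by (intro measurable_restrict_space2 borel_measurable_continuous_on_restrict)
      (auto simp: space_restrict_space)
  then show ?thesis
    using measurable_cong_sets[OF assms refl] by blast
qed

lemma extend_measure_in:
  assumes \<nu>: "\<nu> \<in> inv_measures Z T"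
  shows "extend_measure \<nu> \<in> inv_measures_on X T Z"
proof -
  let ?B = "restrict_space borel X" and ?E = "extend_measure \<nu>"
  have sets: "sets \<nu> = sets (restrict_space borel Z)" and inv: "distr \<nu> \<nu> T = \<nu>"
    using \<nu> by (auto simp: inv_measures_def)
  interpret prob_space \<nu>
    using \<nu> by (simp add: inv_measures_def)
  note incl = measurable_inclusion[OF sets]
  have sp: "space \<nu> = Z"
    by (rule Z.inv_measures_space[OF \<nu>])
  have T\<nu>: "T \<in> measurable \<nu> \<nu>"
    using Z.inv_measures_measurable_funpow[OF \<nu>, of 1] by simp
  have "distr ?E ?E T = distr ?E ?B T"
    by (intro distr_cong) (auto simp: extend_measure_def)
  also have "\<dots> = distr \<nu> ?B T"
    unfolding extend_measure_def by (simp add: distr_distr[OF measurable_restrict_borel incl] o_def)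
  also have "\<dots> = distr (distr \<nu> \<nu> T) ?B (\<lambda>x. x)"
    by (simp add: distr_distr[OF incl T\<nu>] o_def)
  finally have "distr ?E ?E T = ?E"
    using inv by (simp add: extend_measure_def)
  moreover have "emeasure ?E Z = 1"
    unfolding extend_measure_def using emeasure_space_1 sp
    by (simp add: emeasure_distr[OF incl Z_in_sets])
  ultimately show ?thesis
    unfolding inv_measures_on_def inv_measures_def
    by (simp add: extend_measure_def prob_space_distr[OF incl])
qed

lemma mean_extend_measure:
  assumes \<nu>: "\<nu> \<in> inv_measures Z T" and f: "continuous_on X f"
  shows "mean f (extend_measure \<nu>) = mean (restrict f Z) \<nu>"
proof -
  have sets: "sets \<nu> = sets (restrict_space borel Z)"
    using \<nu> by (auto simp: inv_measures_def)
  have int: "(\<integral>x. g x \<partial>extend_measure \<nu>) = (\<integral>x. g x \<partial>\<nu>)" if "continuous_on X g" for g :: "'a \<Rightarrow> real"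
    unfolding extend_measure_def
    by (intro integral_distr measurable_inclusion sets borel_measurable_continuous_on_restrict that)
  have "(\<lambda>n. (1 / real n) * (\<integral>x. \<phi> n x \<partial>extend_measure \<nu>)) = (\<lambda>n. (1 / real n) * (\<integral>x. \<phi> n x \<partial>\<nu>))"
  proof
    \<comment> \<open>Nothing is known about \<open>\<phi> 0\<close>, but at \<open>n = 0\<close>
      the factor \<open>1 / real n\<close> is 0 on both sides.\<close>
    fix n show "(1 / real n) * (\<integral>x. \<phi> n x \<partial>extend_measure \<nu>) = (1 / real n) * (\<integral>x. \<phi> n x \<partial>\<nu>)"
      using int[OF continuous_observable] by (cases "n \<ge> 1") auto
  qed
  moreover have "(\<integral>x. restrict f Z x \<partial>\<nu>) = (\<integral>x. f x \<partial>\<nu>)"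
    using Z.inv_measures_space[OF \<nu>] by (intro Bochner_Integration.integral_cong) auto
  ultimately show ?thesis
    by (simp add: mean_def asymptotic_mean_def int[OF f])
qed

text \<open>Together with \<open>extend_measure_in\<close> this matches the invariant measures of
  the subsystem with those on X carried by Z.\<close>

lemma restrict_measure_in:
  assumes \<mu>: "\<mu> \<in> inv_measures_on X T Z"
  shows "restrict_space \<mu> Z \<in> inv_measures Z T" and "extend_measure (restrict_space \<mu> Z) = \<mu>"
proof -
  let ?R = "restrict_space \<mu> Z"
  have \<mu>X: "\<mu> \<in> inv_measures X T" and sets\<mu>: "sets \<mu> = sets (restrict_space borel X)"
    and inv: "distr \<mu> \<mu> T = \<mu>" and prob: "prob_space \<mu>" and one: "emeasure \<mu> Z = 1"
    using \<mu> by (auto simp: inv_measures_on_def inv_measures_def)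
  have Z\<mu>: "Z \<in> sets \<mu>"
    using Z_in_sets sets\<mu> by simp
  have sp: "space \<mu> = X"
    by (rule inv_measures_space[OF \<mu>X])
  have "sets ?R = sets (restrict_space (restrict_space borel X) Z)"
    by (rule sets_restrict_space_cong[OF sets\<mu>])
  also have "\<dots> = sets (restrict_space borel Z)"
    using Z_sub by (simp add: sets_restrict_restrict_space Int_absorb1)
  finally have setsR: "sets ?R = sets (restrict_space borel Z)" .
  have spR: "space ?R = Z"
    using Z_sub sp by (simp add: space_restrict_space Int_absorb2)
  have emR: "emeasure ?R A = emeasure \<mu> A" if "A \<subseteq> Z" for A
    using Z\<mu> sp Z_sub that by (intro emeasure_restrict_space) (auto simp: Int_absorb2)
  have full: "emeasure \<mu> (A \<inter> Z) = emeasure \<mu> A" if "A \<in> sets \<mu>" for A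
    by (rule emeasure_Int_full[OF prob Z\<mu> one that])
  have T\<mu>: "T \<in> measurable \<mu> \<mu>"
    using inv_measures_measurable_funpow[OF \<mu>X, of 1] by simp
  have TR: "T \<in> measurable ?R ?R"
    using Z.measurable_restrict_borel measurable_cong_sets[OF setsR setsR] by blast
  have "distr ?R ?R T = ?R"
  proof (rule measure_eqI)
    fix A assume "A \<in> sets (distr ?R ?R T)"
    then have AR: "A \<in> sets ?R"
      by simp
    then have A: "A \<subseteq> Z" "A \<in> sets \<mu>"
      using sets_restrict_space_iff[of Z \<mu> A] Z\<mu> by auto
    \<comment> \<open>Z is only forward invariant, so the preimage of \<open>A\<close> in X may
      leave Z; the points outside Z form a null set.\<close>
    have "emeasure (distr ?R ?R T) A = emeasure \<mu> ((T -` A \<inter> X) \<inter> Z)"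
      using emeasure_distr[OF TR AR] emR[of "T -` A \<inter> Z"] spR Z_sub
      by (simp add: Int_assoc Int_absorb1)
    also have "\<dots> = emeasure \<mu> (T -` A \<inter> X)"
      using measurable_sets[OF T\<mu> A(2)] sp by (intro full) simp
    also have "\<dots> = emeasure (distr \<mu> \<mu> T) A"
      using emeasure_distr[OF T\<mu> A(2)] sp by simp
    finally show "emeasure (distr ?R ?R T) A = emeasure ?R A"
      using inv emR[OF A(1)] by simp
  qed simp
  then show "?R \<in> inv_measures Z T"
    using setsR prob_space_restrict_space[OF Z\<mu> one] by (simp add: inv_measures_def)
  show "extend_measure ?R = \<mu>"
  proof (rule measure_eqI)
    show "sets (extend_measure ?R) = sets \<mu>"
      using sets\<mu> by (simp add: extend_measure_def)
    fix A assume "A \<in> sets (extend_measure ?R)"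
    then have A: "A \<in> sets (restrict_space borel X)"
      by (simp add: extend_measure_def)
    have "emeasure (extend_measure ?R) A = emeasure \<mu> (A \<inter> Z)"
      unfolding extend_measure_def
      using emeasure_distr[OF measurable_inclusion[OF setsR] A] emR[of "A \<inter> Z"] spR by simp
    then show "emeasure (extend_measure ?R) A = emeasure \<mu> A"
      using full A sets\<mu> by simp
  qed
qed

lemma extend_orbit_measure:
  assumes "Q \<subseteq> Z"
  shows "extend_measure (orbit_measure Z Q) = orbit_measure X Q"
proof -
  have "(\<lambda>x. x) \<in> measurable (uniform_count_measure Q) (restrict_space borel Z)"
    using assms unfolding measurable_def
    by (auto simp: space_restrict_space space_uniform_count_measure sets_uniform_count_measure)
  then show ?thesis
    unfolding extend_measure_def orbit_measure_def
    by (subst distr_distr[OF measurable_inclusion]) (simp_all add: o_def)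
qed

end

section \<open>Leaves\<close>

context almost_additive_system
begin

sublocale lip: Metric_space "Lip X" "lip_dist X"
  by (rule Metric_space_Lip[OF compact nonempty])

text \<open>
  Comparing suprema instead of maximizing measures makes these sets closed without any appeal to
  weak-* compactness of \<open>inv_measures X T\<close>.
\<close>

definition approx_leaf :: "'a set \<Rightarrow> ('a \<Rightarrow> real) set" where
  "approx_leaf Z = {f \<in> Lip X. \<forall>\<nu>\<in>inv_measures X T. \<forall>e>0.
     \<exists>\<mu>\<in>inv_measures_on X T Z. mean f \<nu> \<le> mean f \<mu> + e}"

lemma Lip_leaf_subset_approx_leaf: "Lip_leaf X T \<phi> Z \<subseteq> approx_leaf Z"
proof
  fix f assume "f \<in> Lip_leaf X T \<phi> Z"
  then obtain \<mu> where f: "f \<in> Lip X" and \<mu>: "\<mu> \<in> max_measures X T (perturb T \<phi> f)" "\<mu> \<in> inv_measures_on X T Z"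
    by (auto simp: Lip_leaf_def)
  then have "mean f \<nu> \<le> mean f \<mu> + e" if "\<nu> \<in> inv_measures X T" "e > 0" for \<nu> e
    using that max_measures_perturb_iff[OF f, of \<mu>] by fastforce
  then show "f \<in> approx_leaf Z"
    using f \<mu>(2) unfolding approx_leaf_def by blast
qed

text \<open>Violations are robust: some \<open>\<nu>\<close> beats every measure on Z by a fixed
  margin \<open>e\<close>, and a small change of \<open>f\<close> moves all means by uniformly
  little.\<close>

lemma closedin_approx_leaf: "closedin (lip_topology X) (approx_leaf Z)"
proof -
  have "\<exists>r>0. lip.mball f r \<subseteq> Lip X - approx_leaf Z" if f: "f \<in> Lip X - approx_leaf Z" for f
  proof -
    obtain \<nu> e where \<nu>: "\<nu> \<in> inv_measures X T" and e: "e > 0"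
      and gap: "\<And>\<mu>. \<mu> \<in> inv_measures_on X T Z \<Longrightarrow> mean f \<nu> > mean f \<mu> + e"
      using f by (auto simp: approx_leaf_def not_le)
    \<comment> \<open>The means at \<open>\<nu>\<close> and at \<open>\<mu>\<close> and the
      approximate inequality for \<open>g\<close> cost \<open>e / 3\<close> each, which exhausts the
      margin.\<close>
    have "g \<notin> approx_leaf Z" if "g \<in> lip.mball f (e / 3)" for g
    proof
      assume "g \<in> approx_leaf Z"
      moreover have "e / 3 > 0"
        using e by simp
      ultimately obtain \<mu> where \<mu>: "\<mu> \<in> inv_measures_on X T Z" and le: "mean g \<nu> \<le> mean g \<mu> + e / 3"
        using \<nu> unfolding approx_leaf_def by blast
      have fg: "f \<in> Lip X" "g \<in> Lip X" and d: "lip_dist X f g < e / 3"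
        using that by (auto simp: lip.in_mball)
      have "\<mu> \<in> inv_measures X T"
        using \<mu> by (simp add: inv_measures_on_def)
      then show False
        using mean_diff_le[OF _ fg, of \<mu>] mean_diff_le[OF \<nu> fg] gap[OF \<mu>] le d by linarith
    qed
    then have "lip.mball f (e / 3) \<subseteq> Lip X - approx_leaf Z"
      by (auto simp: lip.in_mball)
    then show ?thesis
      using e by (intro exI[of _ "e / 3"]) simp
  qed
  then have "openin lip.mtopology (Lip X - approx_leaf Z)"
    unfolding lip.openin_mtopology by blast
  then show ?thesis
    unfolding closedin_def lip_topology_def by (auto simp: approx_leaf_def)
qed

end

section \<open>Functions in the interior of a leaf\<close>

context almost_additive_subsystem
begin

lemma mean_cong_on:
  assumes "\<mu> \<in> inv_measures_on X T Z" "f \<in> Lip X" "g \<in> Lip X" "\<And>z. z \<in> Z \<Longrightarrow> f z = g z"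
  shows "mean f \<mu> = mean g \<mu>"
proof -
  have "restrict f Z = restrict g Z"
    using assms(4) by auto
  then show ?thesis
    using mean_extend_measure[OF restrict_measure_in(1)[OF assms(1)]] restrict_measure_in(2)[OF assms(1)]
      Lip_continuous assms(2,3) by metis
qed

text \<open>Stated for \<open>approx_leaf\<close>, since the Baire step only yields interior points
  of that set. Accordingly the perturbed function \<open>h\<close> is tested with nearly optimal
  measures on Z; it is not assumed to have a maximizing measure.\<close>

lemma max_measures_on_leaf:
  assumes f: "f \<in> lip_topology X interior_of approx_leaf Z"
    and \<nu>: "\<nu> \<in> max_measures X T (perturb T \<phi> f)"
  shows "\<nu> \<in> inv_measures_on X T Z"
proof -
  define \<psi> where "\<psi> x = infdist x Z" for x
  obtain r where fL: "f \<in> Lip X" and r: "r > 0" "lip.mball f r \<subseteq> approx_leaf Z"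
    using f unfolding lip_topology_def lip.metric_interior_of by blast
  have \<nu>X: "\<nu> \<in> inv_measures X T" and max: "\<And>\<mu>. \<mu> \<in> inv_measures X T \<Longrightarrow> mean f \<mu> \<le> mean f \<nu>"
    using \<nu> max_measures_perturb_iff[OF fL] by auto
  have \<psi>c: "continuous_on X \<psi>"
    unfolding \<psi>_def by (intro continuous_intros)
  define D where "D = sup_norm X \<psi>"
  note D = sup_norm_props[OF compact nonempty \<psi>c, folded D_def]
  \<comment> \<open>\<open>c * \<psi>\<close> has sup norm at most \<open>c * D\<close> and
    Lipschitz constant at most \<open>c\<close>, together \<open>r / 2\<close>, so \<open>h\<close>
    stays in the ball around \<open>f\<close>.\<close>
  define c where "c = (r / 2) / (D + 1)"
  have c: "c > 0"
    using r D(1) by (simp add: c_def)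
  have \<psi>L: "c-lipschitz_on X (\<lambda>x. c * \<psi> x)"
  proof (rule lipschitz_onI)
    fix x y
    show "dist (c * \<psi> x) (c * \<psi> y) \<le> c * dist x y"
      using c infdist_triangle_abs[of x Z y] unfolding dist_real_def \<psi>_def
      by (simp add: abs_mult flip: right_diff_distrib)
  qed (use c in simp)
  obtain L where "L-lipschitz_on X f"
    using fL by (auto simp: Lip_def)
  then have "restrict (\<lambda>x. f x + c * \<psi> x) X \<in> Lip X"
    by (rule Lip_restrictI[OF lipschitz_on_add[OF _ \<psi>L]])
  then obtain h where h: "h = restrict (\<lambda>x. f x + c * \<psi> x) X" and hL: "h \<in> Lip X"
    by blast
  have "lip_dist X h f \<le> c * D + c"
  proof (rule lip_dist_le[OF nonempty hL fL])
    show "c-lipschitz_on X (\<lambda>x. h x - f x)"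
      using \<psi>L by (simp add: h)
    show "\<bar>h x - f x\<bar> \<le> c * D" if "x \<in> X" for x
      using D(2)[OF that] c that by (simp add: h abs_mult)
  qed
  also have "c * D + c = c * (D + 1)"
    by (simp add: algebra_simps)
  also have "\<dots> = r / 2"
  proof -
    have "D + 1 \<noteq> 0"
      using D(1) by simp
    then show ?thesis
      using c_def by (metis nonzero_eq_divide_eq)
  qed
  finally have "h \<in> approx_leaf Z"
    using r fL hL lip.commute[of h f] by (intro subsetD[OF r(2)]) (simp add: lip.in_mball)
  note int = inv_measures_integrable[OF \<nu>X]
  have h\<nu>: "mean h \<nu> = mean f \<nu> + c * (\<integral>x. \<psi> x \<partial>\<nu>)"
  proof -
    have "(\<integral>x. h x \<partial>\<nu>) = (\<integral>x. f x + c * \<psi> x \<partial>\<nu>)"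
      using inv_measures_space[OF \<nu>X] by (intro Bochner_Integration.integral_cong) (auto simp: h)
    also have "\<dots> = (\<integral>x. f x \<partial>\<nu>) + c * (\<integral>x. \<psi> x \<partial>\<nu>)"
      using int[OF Lip_continuous[OF fL]] int[OF \<psi>c]
      by (subst Bochner_Integration.integral_add) simp_all
    finally show ?thesis
      by (simp add: mean_def)
  qed
  \<comment> \<open>\<open>\<psi>\<close> vanishes on Z, so measures on Z do not notice the
    perturbation, and their means for \<open>f\<close> are at most that of
    \<open>\<nu>\<close>.\<close>
  have "mean h \<nu> \<le> mean f \<nu> + e" if e: "e > 0" for e
  proof -
    obtain \<mu> where \<mu>: "\<mu> \<in> inv_measures_on X T Z" and le: "mean h \<nu> \<le> mean h \<mu> + e"
      using \<open>h \<in> approx_leaf Z\<close> \<nu>X e unfolding approx_leaf_def by blast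
    have "mean h \<mu> = mean f \<mu>"
      using Z_sub by (intro mean_cong_on \<mu> hL fL) (auto simp: h \<psi>_def)
    moreover have "mean f \<mu> \<le> mean f \<nu>"
      using \<mu> by (intro max) (simp add: inv_measures_on_def)
    ultimately show ?thesis
      using le by simp
  qed
  then have "mean h \<nu> \<le> mean f \<nu>"
    by (rule field_le_epsilon)
  then have "(\<integral>x. \<psi> x \<partial>\<nu>) \<le> 0"
    using h\<nu> c by (simp add: mult_le_0_iff)
  moreover have \<psi>0: "\<psi> x \<ge> 0" for x
    by (simp add: \<psi>_def infdist_nonneg)
  ultimately have "(\<integral>x. \<psi> x \<partial>\<nu>) = 0"
    by (intro antisym integral_nonneg) auto
  then have "AE x in \<nu>. \<psi> x = 0"
    using integral_nonneg_eq_0_iff_AE[OF int[OF \<psi>c]] \<psi>0 by simp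
  then have ae: "AE x in \<nu>. x \<in> Z"
    using in_closed_iff_infdist_zero[OF Z_closed Z_ne] by (simp add: \<psi>_def)
  interpret prob_space \<nu>
    using \<nu>X by (simp add: inv_measures_def)
  have "Z \<in> sets \<nu>"
    using Z_in_sets \<nu>X by (simp add: inv_measures_def)
  then have "emeasure \<nu> Z = 1"
    using ae emeasure_eq_1_AE by blast
  then show ?thesis
    using \<nu>X by (simp add: inv_measures_on_def)
qed

text \<open>A maximizing measure on X restricts to one on Z, because every invariant measure of the
  subsystem extends to a competitor on X.\<close>

lemma uniquely_periodic_lift:
  assumes f: "f \<in> lip_topology X interior_of Lip_leaf X T \<phi> Z"
    and per: "uniquely_periodic Z T \<phi> (restrict f Z)"
  shows "uniquely_periodic X T \<phi> f"
proof -
  have fleaf: "f \<in> Lip_leaf X T \<phi> Z"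
    using subsetD[OF interior_of_subset f] .
  have f': "f \<in> lip_topology X interior_of approx_leaf Z"
    using subsetD[OF interior_of_mono[OF Lip_leaf_subset_approx_leaf] f] .
  have fL: "f \<in> Lip X"
    using fleaf by (simp add: Lip_leaf_def)
  have fZ: "restrict f Z \<in> Lip Z"
    by (rule Lip_restrict_subset[OF fL Z_sub])
  note lift = mean_extend_measure[OF _ Lip_continuous[OF fL]]
  obtain Q where Q: "periodic_orbit Z T Q"
    and max: "max_measures Z T (perturb T \<phi> (restrict f Z)) = {orbit_measure Z Q}"
    using per by (auto simp: uniquely_periodic_def)
  have QX: "periodic_orbit X T Q"
    using Q Z_sub unfolding periodic_orbit_def by blast
  have "Q \<subseteq> Z"
    using Q Z.funpow_in unfolding periodic_orbit_def by auto
  note ext = extend_orbit_measure[OF this]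
  have eq: "\<nu> = orbit_measure X Q" if \<nu>: "\<nu> \<in> max_measures X T (perturb T \<phi> f)" for \<nu>
  proof -
    let ?R = "restrict_space \<nu> Z"
    have on: "\<nu> \<in> inv_measures_on X T Z"
      by (rule max_measures_on_leaf[OF f' \<nu>])
    note R = restrict_measure_in[OF on]
    have "Z.mean (restrict f Z) \<mu> \<le> Z.mean (restrict f Z) ?R" if \<mu>: "\<mu> \<in> inv_measures Z T" for \<mu>
    proof -
      have "extend_measure \<mu> \<in> inv_measures X T"
        using extend_measure_in[OF \<mu>] by (simp add: inv_measures_on_def)
      then have "mean f (extend_measure \<mu>) \<le> mean f (extend_measure ?R)"
        using \<nu> R(2) max_measures_perturb_iff[OF fL] by simp
      then show ?thesis
        using lift[OF \<mu>] lift[OF R(1)] by simp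
    qed
    then have "?R \<in> max_measures Z T (perturb T \<phi> (restrict f Z))"
      using Z.max_measures_perturb_iff[OF fZ] R(1) by blast
    then have "?R = orbit_measure Z Q"
      using max by simp
    then show ?thesis
      using R(2) ext by simp
  qed
  \<comment> \<open>Leaf membership supplies some maximizing measure. By \<open>eq\<close> it is the
    orbit measure, whose maximality thus follows without a direct check.\<close>
  moreover have "max_measures X T (perturb T \<phi> f) \<noteq> {}"
    using fleaf by (auto simp: Lip_leaf_def)
  ultimately have "max_measures X T (perturb T \<phi> f) = {orbit_measure X Q}"
    by blast
  then show ?thesis
    using QX unfolding uniquely_periodic_def by blast
qed

lemma openin_restrict_vimage:
  assumes V: "openin (lip_topology Z) V"
  shows "openin (lip_topology X) {f \<in> Lip X. restrict f Z \<in> V}"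
  unfolding lip_topology_def lip.openin_mtopology
proof (intro conjI allI impI)
  fix f assume "f \<in> {f \<in> Lip X. restrict f Z \<in> V}"
  then have f: "f \<in> Lip X" "restrict f Z \<in> V"
    by auto
  then obtain r where r: "r > 0" "Z.lip.mball (restrict f Z) r \<subseteq> V"
    using V unfolding lip_topology_def Z.lip.openin_mtopology by blast
  \<comment> \<open>The radius \<open>r / 2\<close> compensates for the factor 2 in
    \<open>lip_dist_restrict_le\<close>.\<close>
  have "restrict g Z \<in> V" if g: "g \<in> lip.mball f (r / 2)" for g
  proof -
    have gL: "g \<in> Lip X" and d: "lip_dist X f g < r / 2"
      using g by (auto simp: lip.in_mball)
    have "restrict g Z \<in> Z.lip.mball (restrict f Z) r"
      using lip_dist_restrict_le[OF compact Z_ne Z_sub f(1) gL] d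
        Lip_restrict_subset[OF f(1) Z_sub] Lip_restrict_subset[OF gL Z_sub]
      by (simp add: Z.lip.in_mball)
    then show ?thesis
      using r by blast
  qed
  then show "\<exists>r>0. lip.mball f r \<subseteq> {f \<in> Lip X. restrict f Z \<in> V}"
    using r(1) by (intro exI[of _ "r / 2"]) (auto simp: lip.in_mball)
qed auto

text \<open>As \<open>periodic_locus\<close> is an interior, a single uniquely periodic function
  near \<open>f\<close> would not suffice; the approximant has to lie in the open set
  \<open>?W\<close> of such functions.\<close>

lemma periodic_locus_meets:
  assumes tpo: "relative_TPO Z T \<phi>" and U: "openin (lip_topology X) U"
    and ne: "U \<inter> lip_topology X interior_of Lip_leaf X T \<phi> Z \<noteq> {}"
  shows "U \<inter> periodic_locus X T \<phi> \<noteq> {}"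
proof -
  let ?I = "lip_topology X interior_of Lip_leaf X T \<phi> Z"
  obtain V where V: "openin (lip_topology Z) V" "lip_topology Z closure_of V = Lip Z"
    and per: "\<And>g. g \<in> V \<Longrightarrow> uniquely_periodic Z T \<phi> g"
    using tpo topspace_lip_topology[OF Z.compact Z.nonempty]
    unfolding relative_TPO_def open_dense_def by auto
  let ?W = "?I \<inter> {f \<in> Lip X. restrict f Z \<in> V}"
  have "openin (lip_topology X) ?W"
    by (intro openin_Int openin_interior_of openin_restrict_vimage V)
  moreover have "?W \<subseteq> {f \<in> Lip X. uniquely_periodic X T \<phi> f}"
    using uniquely_periodic_lift per by blast
  ultimately have W: "?W \<subseteq> periodic_locus X T \<phi>"
    unfolding periodic_locus_def by (rule interior_of_maximal[rotated])
  obtain f where f: "f \<in> U \<inter> ?I"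
    using ne by blast
  have "openin lip.mtopology (U \<inter> ?I)"
    using openin_Int[OF U openin_interior_of] by (simp add: lip_topology_def)
  then obtain r where fL: "f \<in> Lip X" and r: "r > 0" "lip.mball f r \<subseteq> U \<inter> ?I"
    using f unfolding lip.openin_mtopology by blast
  obtain g where g: "g \<in> Lip X" "lip_dist X f g < r" "restrict g Z \<in> V"
    using Lip_approximate_extension[OF compact Z.compact Z_ne Z_sub fL V(2) r(1)] by blast
  then have "g \<in> lip.mball f r"
    using fL by (simp add: lip.in_mball)
  then show ?thesis
    using g W r(2) by blast
qed

end

section \<open>The Baire argument and density\<close>

context almost_additive_system
begin

lemma subsystemI:
  "Z \<noteq> {} \<Longrightarrow> closed_invariant X T Z \<Longrightarrow> almost_additive_subsystem X T \<phi> Z"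
  by unfold_locales

lemma leaf_interiors_dense:
  assumes cnt: "countable \<Z>" and \<Z>: "\<And>Z. Z \<in> \<Z> \<Longrightarrow> Z \<noteq> {} \<and> closed_invariant X T Z"
    and leaf: "leafwise_maximizable X T \<phi> \<Z>"
    and U: "openin (lip_topology X) U" "U \<noteq> {}"
  obtains Z where "Z \<in> \<Z>" "U \<inter> lip_topology X interior_of Lip_leaf X T \<phi> Z \<noteq> {}"
proof -
  have cover: "\<exists>Z\<in>\<Z>. f \<in> Lip_leaf X T \<phi> Z" if "f \<in> Lip X" for f
    using leaf that unfolding leafwise_maximizable_def by blast
  \<comment> \<open>The covering gives \<open>f\<close> a maximizing measure, possibly through
    another leaf; at an interior point of \<open>approx_leaf Z\<close> that measure is carried by Z
    nevertheless.\<close>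
  have "lip_topology X interior_of approx_leaf Z \<subseteq> Lip_leaf X T \<phi> Z" if Z: "Z \<in> \<Z>" for Z
  proof
    fix f assume f: "f \<in> lip_topology X interior_of approx_leaf Z"
    then have fL: "f \<in> Lip X"
      using interior_of_subset unfolding approx_leaf_def by fastforce
    obtain \<nu> where \<nu>: "\<nu> \<in> max_measures X T (perturb T \<phi> f)"
      using cover[OF fL] by (auto simp: Lip_leaf_def)
    interpret almost_additive_subsystem X T \<phi> Z
      using \<Z>[OF Z] by (intro subsystemI) auto
    show "f \<in> Lip_leaf X T \<phi> Z"
      using max_measures_on_leaf[OF f \<nu>] \<nu> fL by (auto simp: Lip_leaf_def)
  qed
  then have int: "lip_topology X interior_of approx_leaf Z \<subseteq> lip_topology X interior_of Lip_leaf X T \<phi> Z"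
    if "Z \<in> \<Z>" for Z
    using that by (intro interior_of_maximal openin_interior_of)
  obtain f r where fL: "f \<in> Lip X" and r: "r > 0" "lip.mcball f r \<subseteq> U"
    using U unfolding lip_topology_def lip.openin_mtopology_mcball by blast
  \<comment> \<open>Cutting with a closed ball inside \<open>U\<close> keeps the pieces closed and
    forces their interior points into \<open>U\<close>.\<close>
  let ?\<G> = "(\<lambda>Z. approx_leaf Z \<inter> lip.mcball f r) ` \<Z>"
  have "\<exists>Z\<in>\<Z>. U \<inter> lip_topology X interior_of approx_leaf Z \<noteq> {}"
  proof (rule ccontr)
    assume none: "\<not> ?thesis"
    have "lip.mtopology interior_of \<Union>?\<G> = {}"
    proof (rule lip.metric_Baire_category_alt[OF mcomplete_Lip[OF compact nonempty]])
      show "countable ?\<G>"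
        using cnt by blast
      fix G assume "G \<in> ?\<G>"
      then obtain Z where Z: "Z \<in> \<Z>" "G = approx_leaf Z \<inter> lip.mcball f r"
        by blast
      have "lip.mtopology interior_of G \<subseteq> U \<inter> lip_topology X interior_of approx_leaf Z"
        using Z(2) r(2) interior_of_subset[of lip.mtopology G] interior_of_mono[of G "approx_leaf Z"]
        unfolding lip_topology_def by blast
      then have "lip.mtopology interior_of G = {}"
        using none Z(1) by blast
      moreover have "closedin lip.mtopology G"
        using closedin_approx_leaf unfolding Z(2) lip_topology_def
        by (intro closedin_Int lip.closedin_mcball)
      ultimately show "closedin lip.mtopology G \<and> lip.mtopology interior_of G = {}"
        by blast
    qed
    moreover have "lip.mball f r \<subseteq> \<Union>?\<G>"
    proof
      fix g assume g: "g \<in> lip.mball f r"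
      then have "g \<in> Lip X"
        by (simp add: lip.in_mball)
      then obtain Z where "Z \<in> \<Z>" "g \<in> approx_leaf Z"
        using cover Lip_leaf_subset_approx_leaf by blast
      then show "g \<in> \<Union>?\<G>"
        using g lip.mball_subset_mcball by blast
    qed
    then have "lip.mball f r \<subseteq> lip.mtopology interior_of \<Union>?\<G>"
      by (intro interior_of_maximal lip.openin_mball)
    ultimately show False
      using fL r(1) lip.centre_in_mball_iff[of f r] by blast
  qed
  then show thesis
    using that int by blast
qed

lemma open_dense_lip_topologyI:
  assumes "openin (lip_topology X) W"
    and "\<And>U. openin (lip_topology X) U \<Longrightarrow> U \<noteq> {} \<Longrightarrow> U \<inter> W \<noteq> {}"
  shows "open_dense (lip_topology X) W"
  using assms dense_intersects_open[of "lip_topology X" W] unfolding open_dense_def by blast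

text \<open>The open set \<open>E\<close> absorbs the interiors of leaves without the TPO property,
  so that one argument covers families with and without a boundary set.\<close>

lemma open_dense_periodic_locus_Un:
  assumes cnt: "countable \<Z>" and \<Z>: "\<And>Z. Z \<in> \<Z> \<Longrightarrow> Z \<noteq> {} \<and> closed_invariant X T Z"
    and leaf: "leafwise_maximizable X T \<phi> \<Z>"
    and tpo: "\<And>Z. Z \<in> \<Z> \<Longrightarrow> relative_TPO Z T \<phi> \<or> lip_topology X interior_of Lip_leaf X T \<phi> Z \<subseteq> E"
    and E: "openin (lip_topology X) E"
  shows "open_dense (lip_topology X) (periodic_locus X T \<phi> \<union> E)"
proof (rule open_dense_lip_topologyI)
  show "openin (lip_topology X) (periodic_locus X T \<phi> \<union> E)"
    unfolding periodic_locus_def by (intro openin_Un openin_interior_of E)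
  fix U assume U: "openin (lip_topology X) U" "U \<noteq> {}"
  obtain Z where Z: "Z \<in> \<Z>" and meets: "U \<inter> lip_topology X interior_of Lip_leaf X T \<phi> Z \<noteq> {}"
    using leaf_interiors_dense[OF cnt \<Z> leaf U] by blast
  interpret almost_additive_subsystem X T \<phi> Z
    using \<Z>[OF Z] by (intro subsystemI) auto
  show "U \<inter> (periodic_locus X T \<phi> \<union> E) \<noteq> {}"
    using tpo[OF Z] periodic_locus_meets[OF _ U(1) meets] meets by blast
qed

lemma relative_TPO_if_dense:
  assumes "open_dense (lip_topology X) (periodic_locus X T \<phi>)"
  shows "relative_TPO X T \<phi>"
proof -
  have "periodic_locus X T \<phi> \<subseteq> {f \<in> Lip X. uniquely_periodic X T \<phi> f}"
    unfolding periodic_locus_def by (rule interior_of_subset)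
  then show ?thesis
    using assms unfolding relative_TPO_def by blast
qed

end

theorem mainTheorem3:
  fixes X :: "'a::metric_space set" and T :: "'a \<Rightarrow> 'a" and \<phi> :: "nat \<Rightarrow> 'a \<Rightarrow> real"
    and Z :: "nat \<Rightarrow> 'a set"
  assumes "compact X" and "X \<noteq> {}"
    and "continuous_on X T" and "T ` X \<subseteq> X"
    and "almost_additive X T \<phi>"
    and "\<And>i. i \<ge> 1 \<Longrightarrow> Z i \<noteq> {} \<and> closed_invariant X T (Z i)"
    and "\<And>i. i \<ge> 1 \<Longrightarrow> relative_TPO (Z i) T \<phi>"
  shows "(Z 0 \<noteq> {} \<and> closed_invariant X T (Z 0) \<and>
            leafwise_maximizable X T \<phi> ({Z 0} \<union> {Z i | i. i \<ge> 1}) \<longrightarrow>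
          open_dense (lip_topology X)
            (periodic_locus X T \<phi> \<union> lip_topology X interior_of Lip_leaf X T \<phi> (Z 0)) \<and>
          (lip_topology X interior_of Lip_leaf X T \<phi> (Z 0) = {} \<longrightarrow> relative_TPO X T \<phi>))
       \<and> (leafwise_maximizable X T \<phi> {Z i | i. i \<ge> 1} \<longrightarrow>
          open_dense (lip_topology X) (periodic_locus X T \<phi>) \<and> relative_TPO X T \<phi>)"
proof -
  interpret almost_additive_system X T \<phi>
    by unfold_locales (fact assms)+
  let ?E = "lip_topology X interior_of Lip_leaf X T \<phi> (Z 0)"
  have "{Z i | i. i \<ge> 1} = Z ` {1..}"
    by auto
  then have cnt: "countable {Z i | i. i \<ge> 1}"
    by simp
  \<comment> \<open>With \<open>E\<close> the interior of the boundary leaf, \<open>Z 0\<close>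
    satisfies the second alternative trivially.\<close>
  have with_boundary: "open_dense (lip_topology X) (periodic_locus X T \<phi> \<union> ?E)"
    if "Z 0 \<noteq> {} \<and> closed_invariant X T (Z 0) \<and>
      leafwise_maximizable X T \<phi> ({Z 0} \<union> {Z i | i. i \<ge> 1})"
    by (rule open_dense_periodic_locus_Un[where \<Z> = "{Z 0} \<union> {Z i | i. i \<ge> 1}"])
      (use that cnt assms(6,7) openin_interior_of in auto)
  \<comment> \<open>Every member has the TPO property here, so \<open>E\<close> can be
    empty.\<close>
  have without_boundary: "open_dense (lip_topology X) (periodic_locus X T \<phi>)"
    if "leafwise_maximizable X T \<phi> {Z i | i. i \<ge> 1}"
    using open_dense_periodic_locus_Un[where \<Z> = "{Z i | i. i \<ge> 1}" and E = "{}"]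
      that cnt assms(6,7) by auto
  show ?thesis
  proof (intro conjI impI with_boundary without_boundary)
    assume "Z 0 \<noteq> {} \<and> closed_invariant X T (Z 0) \<and>
        leafwise_maximizable X T \<phi> ({Z 0} \<union> {Z i | i. i \<ge> 1})" and "?E = {}"
    then show "relative_TPO X T \<phi>"
      using with_boundary relative_TPO_if_dense by simp
  qed (use without_boundary relative_TPO_if_dense in blast)+
qed

end
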